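(* Let $A\in\mathbb{R}\setminus\{0\}$ and $B,a_0,b_0\in\mathbb{R}$ with $a_0+b_0=B$, and put $a(\epsilon)=a_0+\frac{A}{\epsilon}$, $b(\epsilon)=b_0-\frac{A}{\epsilon}$ for $\epsilon\in(0,1]$; assume $b(\epsilon)\ne0$ for all $\epsilon\in(0,1]$. Let $L>0$, let $0\neq\psi\in L^2(\mathbb{R},dx)$ have support contained in $[-L,L]$, let $p_0=\frac{\pi}{AL}$ and let $q_0\in\mathbb{R}$ satisfy $|q_0p_0|<2\pi$. Suppose there is a constant $\chi>0$ with $\sum_{n\in\mathbb{Z}}|\psi(x+nq_0)|^2=\chi$ for all $x\in\mathbb{R}$. Then for any $f\in L^2(\mathbb{R},dx)$ and any $\epsilon\in(0,1]$, $$f=\sum_{n,m\in\mathbb{Z}}\frac{\epsilon}{2\chi\sinh(\epsilon L)}\langle\psi^{\epsilon,a(\epsilon),b(\epsilon)}_{(n,m)}|f\rangle\,|\psi^{\epsilon,a(\epsilon),b(\epsilon)}_{(n,m)}\rangle=\sum_{n,m\in\mathbb{Z}}\frac{1}{2\chi L}\langle\psi^{A,B}_{(n,m)}|f\rangle\,|\psi^{A,B}_{(n,m)}\rangle,$$ where the equalities are in $L^2(\mathbb{R},dx)$.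
   Context: Inner products are linear in the second argument. Heisenberg side: $\eta^{A,B}$ is the representation on $L^2(\mathbb{R})$ of the Heisenberg group $H$ ($\mathbb{R}\times\mathbb{R}^2$ with product $(x_1,(y_1,z_1))(x_2,(y_2,z_2))=(x_1+x_2,(y_1+y_2+x_1z_2,z_1+z_2))$) given by $(\eta^{A,B}(c,(v_1,v_2))f)(x)=e^{i[A(v_1+xv_2)+Bv_2]}f(c+x)$, and $|\psi^{A,B}_{(n,m)}\rangle=\eta^{A,B}\big(nq_0,(\tfrac{nq_0mp_0}{2},mp_0)\big)\psi$. Extended affine side: for $\epsilon\in(0,1]$, $a\in\mathbb{R}$, $b\ne0$, $\rho_\epsilon^{a,b}$ is the representation on $L^2(\mathbb{R})$ of $EA=\mathbb{R}^+\times\mathbb{R}\times\mathbb{R}$ (product $(\alpha,\beta,\gamma)(x,y,z)=(\alpha x,\alpha y+\beta,\gamma+z)$) given by $(\rho_\epsilon^{a,b}(\alpha,\beta,\gamma)f)(x)=e^{ia\gamma}e^{ib\beta e^{-\epsilon x}}f\big(x-\tfrac{\log\alpha}{\epsilon}\big)$. Put $\alpha_n(\epsilon)=e^{-\epsilon nq_0}$, $\beta_{mn}(\epsilon)=-\frac{2\pi m\,e^{-\epsilon nq_0}}{b(\epsilon)(e^{\epsilon L}-e^{-\epsilon L})}$, $\gamma_{mn}(\epsilon)=\beta_{mn}(\epsilon)\frac{\ln\alpha_n(\epsilon)}{\alpha_n(\epsilon)-1}$ (the quotient is $1$ when $\alpha_n(\epsilon)=1$), $Q_\epsilon(x)=e^{-\frac12\epsilon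 x}$, and $|\psi^{\epsilon,a(\epsilon),b(\epsilon)}_{(n,m)}\rangle=\rho_\epsilon^{a(\epsilon),b(\epsilon)}(\alpha_n(\epsilon),\beta_{mn}(\epsilon),\gamma_{mn}(\epsilon))(Q_\epsilon\psi)$. *)

theory Defs
  imports "HOL-Analysis.Analysis"
begin

section \<open>The Hilbert space of square-integrable functions on the real line\<close>

text \<open>Elements are represented by functions; equality in the Hilbert space is equality almost
  everywhere, i.e. vanishing of \<open>L2_norm\<close> of the difference.\<close>

definition L2 :: "(real \<Rightarrow> complex) set" where
  "L2 = {f. f \<in> borel_measurable lebesgue \<and> integrable lebesgue (\<lambda>x. (cmod (f x))\<^sup>2)}"

definition L2_norm :: "(real \<Rightarrow> complex) \<Rightarrow> real" where
  "L2_norm f = sqrt (LINT x|lebesgue. (cmod (f x))\<^sup>2)"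

definition L2_inner :: "(real \<Rightarrow> complex) \<Rightarrow> (real \<Rightarrow> complex) \<Rightarrow> complex" where
  "L2_inner g f = (LINT x|lebesgue. cnj (g x) * f x)"

text \<open>The analogue of \<^const>\<open>has_sum\<close> for the topology of \<open>L2_norm\<close>. The membership conditions are
  needed because \<open>L2_norm\<close> takes the value \<open>0\<close> on functions that are not square-integrable.\<close>

definition L2_has_sum :: "('i \<Rightarrow> real \<Rightarrow> complex) \<Rightarrow> (real \<Rightarrow> complex) \<Rightarrow> 'i set \<Rightarrow> bool" where
  "L2_has_sum g f I \<longleftrightarrow> f \<in> L2 \<and> (\<forall>i\<in>I. g i \<in> L2) \<and>
     ((\<lambda>F. L2_norm (\<lambda>x. f x - (\<Sum>i\<in>F. g i x))) \<longlongrightarrow> 0) (finite_subsets_at_top I)"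

section \<open>Heisenberg group\<close>

type_synonym heis = "real \<times> real \<times> real"

definition heis_mult :: "heis \<Rightarrow> heis \<Rightarrow> heis" where
  "heis_mult = (\<lambda>(x1, (y1, z1)) (x2, (y2, z2)). (x1 + x2, (y1 + y2 + x1 * z2, z1 + z2)))"

definition heis_rep :: "real \<Rightarrow> real \<Rightarrow> heis \<Rightarrow> (real \<Rightarrow> complex) \<Rightarrow> real \<Rightarrow> complex" where
  "heis_rep A B = (\<lambda>(c, (v1, v2)) f x. cis (A * (v1 + x * v2) + B * v2) * f (c + x))"

lemma heis_rep_mult: "heis_rep A B (heis_mult g h) f = heis_rep A B g (heis_rep A B h f)"
  by (auto simp: heis_rep_def heis_mult_def fun_eq_iff cis_mult algebra_simps split: prod.splits)

definition heis_vec ::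
  "real \<Rightarrow> real \<Rightarrow> real \<Rightarrow> real \<Rightarrow> (real \<Rightarrow> complex) \<Rightarrow> int \<Rightarrow> int \<Rightarrow> real \<Rightarrow> complex" where
  "heis_vec A B q0 p0 \<psi> n m =
     heis_rep A B
       (of_int n * q0, ((of_int n * q0) * (of_int m * p0) / 2, of_int m * p0)) \<psi>"

section \<open>Extended affine group\<close>

text \<open>Group elements are the triples with positive first component.\<close>

type_synonym ea = "real \<times> real \<times> real"

definition ea_mult :: "ea \<Rightarrow> ea \<Rightarrow> ea" where
  "ea_mult = (\<lambda>(\<alpha>, \<beta>, \<gamma>) (x, y, z). (\<alpha> * x, \<alpha> * y + \<beta>, \<gamma> + z))"

definition ea_rep :: "real \<Rightarrow> real \<Rightarrow> real \<Rightarrow> ea \<Rightarrow> (real \<Rightarrow> complex) \<Rightarrow> real \<Rightarrow> complex" where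
  "ea_rep \<epsilon> a b = (\<lambda>(\<alpha>, \<beta>, \<gamma>) f x.
     cis (a * \<gamma>) * cis (b * \<beta> * exp (- (\<epsilon> * x))) * f (x - ln \<alpha> / \<epsilon>))"

lemma ea_rep_mult:
  assumes "\<epsilon> > 0" "fst g > 0" "fst h > 0"
  shows "ea_rep \<epsilon> a b (ea_mult g h) f = ea_rep \<epsilon> a b g (ea_rep \<epsilon> a b h f)"
proof -
  obtain \<alpha> \<beta> \<gamma> x y z where gh: "g = (\<alpha>, \<beta>, \<gamma>)" "h = (x, y, z)"
    by (metis prod_cases3)
  have pos: "\<alpha> > 0" "x > 0" using assms gh by auto
  have e: "exp (- (\<epsilon> * (t - ln \<alpha> / \<epsilon>))) = \<alpha> * exp (- (\<epsilon> * t))" for t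
  proof -
    have "- (\<epsilon> * (t - ln \<alpha> / \<epsilon>)) = ln \<alpha> + - (\<epsilon> * t)"
      using assms(1) by (simp add: right_diff_distrib)
    then show ?thesis using pos by (simp only: exp_add exp_ln)
  qed
  have l: "t - ln (\<alpha> * x) / \<epsilon> = t - ln \<alpha> / \<epsilon> - ln x / \<epsilon>" for t
    using pos by (simp add: ln_mult add_divide_distrib)
  show ?thesis
    unfolding gh ea_rep_def ea_mult_def
    by (simp add: fun_eq_iff e l cis_mult mult.assoc[symmetric]) (simp add: algebra_simps)
qed

definition ea_alpha :: "real \<Rightarrow> real \<Rightarrow> int \<Rightarrow> real" where
  "ea_alpha q0 \<epsilon> n = exp (- (\<epsilon> * of_int n * q0))"

definition ea_beta :: "real \<Rightarrow> real \<Rightarrow> real \<Rightarrow> real \<Rightarrow> int \<Rightarrow> int \<Rightarrow> real" where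
  "ea_beta q0 L \<epsilon> b m n =
     - (2 * pi * of_int m * exp (- (\<epsilon> * of_int n * q0))) / (b * (exp (\<epsilon> * L) - exp (- (\<epsilon> * L))))"

definition ea_gamma :: "real \<Rightarrow> real \<Rightarrow> real \<Rightarrow> real \<Rightarrow> int \<Rightarrow> int \<Rightarrow> real" where
  "ea_gamma q0 L \<epsilon> b m n =
     ea_beta q0 L \<epsilon> b m n *
       (if ea_alpha q0 \<epsilon> n = 1 then 1 else ln (ea_alpha q0 \<epsilon> n) / (ea_alpha q0 \<epsilon> n - 1))"

definition Q_fun :: "real \<Rightarrow> real \<Rightarrow> real" where
  "Q_fun \<epsilon> x = exp (- (1 / 2) * \<epsilon> * x)"

definition ea_vec ::
  "real \<Rightarrow> real \<Rightarrow> real \<Rightarrow> real \<Rightarrow> real \<Rightarrow> (real \<Rightarrow> complex) \<Rightarrow> int \<Rightarrow> int \<Rightarrow> real \<Rightarrow> complex" where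
  "ea_vec q0 L \<epsilon> a b \<psi> n m =
     ea_rep \<epsilon> a b (ea_alpha q0 \<epsilon> n, ea_beta q0 L \<epsilon> b m n, ea_gamma q0 L \<epsilon> b m n)
       (\<lambda>x. of_real (Q_fun \<epsilon> x) * \<psi> x)"

end

theory Submission
  imports Defs
begin

text \<open>
  Both families consist of the functions
  \<open>v n m x = c\<^sub>n\<^sub>m * cis (2 * pi * m * \<phi> (x + n * q0)) * w (x + n * q0) * \<psi> (x + n * q0)\<close> with
  \<open>\<bar>c\<^sub>n\<^sub>m\<bar> = 1\<close>, where \<open>\<phi>\<close> increases by exactly \<open>1\<close> over \<open>[-L, L]\<close> and \<open>w\<^sup>2 = C * \<phi>'\<close> for a
  constant \<open>C\<close>: on the Heisenberg side \<open>\<phi> y = y / (2 * L)\<close>, \<open>w = 1\<close> and \<open>C = 2 * L\<close>; on the affine side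
  \<open>\<phi> y = - exp (- \<epsilon> * y) / T\<close>, \<open>w = Q\<^sub>\<epsilon>\<close> and \<open>C = T / \<epsilon>\<close> with \<open>T = 2 * sinh (\<epsilon> * L)\<close>.
  The exponentials \<open>cis (2 * pi * m * \<phi>)\<close> form an orthonormal basis of \<open>L\<^sup>2([-L, L], \<phi>' dx)\<close>, so
  Parseval's identity for fixed \<open>n\<close> gives
  \<open>(\<Sum>m. \<bar>\<langle>v n m | f\<rangle>\<bar>\<^sup>2) = C * (\<integral>\<bar>\<psi> (x + n * q0)\<bar>\<^sup>2 * \<bar>f x\<bar>\<^sup>2 dx)\<close>. Summing over \<open>n\<close> yields a tight frame with
  constant \<open>C * \<chi>\<close>, and a tight frame reproduces every vector with unconditional convergence.
\<close>

section \<open>Tight frames and Parseval's identity in \<open>L\<^sup>2\<close>\<close>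

text \<open>The measure is a parameter because two of them occur: Lebesgue measure carries the
  frames, while the Fourier series live in a weighted space over an interval.\<close>

definition sq_integrable :: "'a measure \<Rightarrow> ('a \<Rightarrow> complex) set" where
  "sq_integrable M = {f. f \<in> borel_measurable M \<and> integrable M (\<lambda>x. (cmod (f x))\<^sup>2)}"

definition sq_inner :: "'a measure \<Rightarrow> ('a \<Rightarrow> complex) \<Rightarrow> ('a \<Rightarrow> complex) \<Rightarrow> complex" where
  "sq_inner M g f = (LINT x|M. cnj (g x) * f x)"

definition sq_norm2 :: "'a measure \<Rightarrow> ('a \<Rightarrow> complex) \<Rightarrow> real" where
  "sq_norm2 M f = (LINT x|M. (cmod (f x))\<^sup>2)"

lemma sq_integrable_measurable: "f \<in> sq_integrable M \<Longrightarrow> f \<in> borel_measurable M"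
  by (simp add: sq_integrable_def)

lemma sq_norm2_nonneg: "0 \<le> sq_norm2 M f"
  by (simp add: sq_norm2_def)

lemma sq_integrable_bound:
  assumes "f \<in> borel_measurable M" "integrable M g" "AE x in M. (cmod (f x))\<^sup>2 \<le> g x"
  shows "f \<in> sq_integrable M"
proof -
  have "integrable M (\<lambda>x. (cmod (f x))\<^sup>2)"
    using assms(1,3) by (intro Bochner_Integration.integrable_bound[OF assms(2)]) auto
  then show ?thesis using assms(1) by (simp add: sq_integrable_def)
qed

lemma cmod_add_sq_le: "(cmod (a + b))\<^sup>2 \<le> 2 * (cmod a)\<^sup>2 + 2 * (cmod b)\<^sup>2"
proof -
  have "(cmod (a + b))\<^sup>2 \<le> (cmod a + cmod b)\<^sup>2"
    by (intro power_mono norm_triangle_ineq) auto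
  also have "\<dots> \<le> 2 * (cmod a)\<^sup>2 + 2 * (cmod b)\<^sup>2"
    using sum_squares_bound[of "cmod a" "cmod b"] by (simp add: power2_sum)
  finally show ?thesis .
qed

lemma sq_integrable_add:
  assumes "f \<in> sq_integrable M" "g \<in> sq_integrable M"
  shows "(\<lambda>x. f x + g x) \<in> sq_integrable M"
  using assms cmod_add_sq_le
  by (intro sq_integrable_bound[where g = "\<lambda>x. 2 * (cmod (f x))\<^sup>2 + 2 * (cmod (g x))\<^sup>2"])
     (auto simp: sq_integrable_def)

lemma sq_integrable_scale:
  assumes "f \<in> sq_integrable M"
  shows "(\<lambda>x. c * f x) \<in> sq_integrable M"
  using assms by (auto simp: sq_integrable_def norm_mult power_mult_distrib)

lemma sq_integrable_diff:
  assumes "f \<in> sq_integrable M" "g \<in> sq_integrable M"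
  shows "(\<lambda>x. f x - g x) \<in> sq_integrable M"
  using sq_integrable_add[OF assms(1) sq_integrable_scale[OF assms(2), of "-1"]] by simp

lemma sq_integrable_sum:
  assumes "\<And>i. i \<in> F \<Longrightarrow> v i \<in> sq_integrable M"
  shows "(\<lambda>x. \<Sum>i\<in>F. c i * v i x) \<in> sq_integrable M"
  using assms
proof (induction F rule: infinite_finite_induct)
  case (insert i F)
  then show ?case by (simp add: sq_integrable_add sq_integrable_scale)
qed (auto simp: sq_integrable_def)

lemma integrable_cnj_mult:
  assumes "f \<in> sq_integrable M" "g \<in> sq_integrable M"
  shows "integrable M (\<lambda>x. cnj (g x) * f x)"
proof (rule Bochner_Integration.integrable_bound)
  show "integrable M (\<lambda>x. (cmod (f x))\<^sup>2 + (cmod (g x))\<^sup>2)"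
    using assms by (auto simp: sq_integrable_def)
  have "cmod (f x) * cmod (g x) \<le> (cmod (f x))\<^sup>2 + (cmod (g x))\<^sup>2" for x
  proof -
    have "2 * (cmod (f x) * cmod (g x)) \<le> (cmod (f x))\<^sup>2 + (cmod (g x))\<^sup>2"
      using sum_squares_bound[of "cmod (f x)" "cmod (g x)"] by simp
    moreover have "0 \<le> cmod (f x) * cmod (g x)" by simp
    ultimately show ?thesis by linarith
  qed
  then show "AE x in M. norm (cnj (g x) * f x) \<le> norm ((cmod (f x))\<^sup>2 + (cmod (g x))\<^sup>2)"
    by (simp add: norm_mult mult.commute)
  have "(\<lambda>x. cnj (g x)) \<in> borel_measurable M"
    using assms(2) by (intro measurable_compose[OF sq_integrable_measurable borel_measurable_continuous_onI]
        continuous_on_cnj continuous_on_id)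
  then show "(\<lambda>x. cnj (g x) * f x) \<in> borel_measurable M"
    using assms(1) by (auto simp: sq_integrable_def)
qed

lemma sq_inner_cnj: "cnj (sq_inner M f g) = sq_inner M g f"
  unfolding sq_inner_def
  unfolding Bochner_Integration.integral_cnj[symmetric] by (simp add: mult.commute)

lemma sq_inner_add:
  assumes "f \<in> sq_integrable M" "f' \<in> sq_integrable M" "g \<in> sq_integrable M"
  shows "sq_inner M g (\<lambda>x. f x + f' x) = sq_inner M g f + sq_inner M g f'"
  unfolding sq_inner_def using assms by (simp add: ring_distribs integrable_cnj_mult)

lemma sq_inner_scale: "sq_inner M g (\<lambda>x. c * f x) = c * sq_inner M g f"
  unfolding sq_inner_def by (simp flip: integral_mult_right_zero add: mult_ac)

lemma sq_inner_sum:
  assumes "\<And>i. i \<in> F \<Longrightarrow> v i \<in> sq_integrable M" "g \<in> sq_integrable M"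
  shows "sq_inner M g (\<lambda>x. \<Sum>i\<in>F. c i * v i x) = (\<Sum>i\<in>F. c i * sq_inner M g (v i))"
  using assms
proof (induction F rule: infinite_finite_induct)
  case (insert i F)
  then show ?case by (simp add: sq_inner_add sq_inner_scale sq_integrable_scale sq_integrable_sum)
qed (auto simp: sq_inner_def)

lemma sq_inner_self: "sq_inner M f f = of_real (sq_norm2 M f)"
  unfolding sq_inner_def sq_norm2_def
  unfolding integral_complex_of_real[symmetric] complex_norm_square by (simp add: mult.commute)

lemma sq_norm2_diff:
  assumes "f \<in> sq_integrable M" "g \<in> sq_integrable M"
  shows "sq_norm2 M (\<lambda>x. f x - g x) = sq_norm2 M f - 2 * Re (sq_inner M f g) + sq_norm2 M g"
proof -
  define r where "r x = Re (cnj (f x) * g x)" for x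
  have *: "(cmod (f x - g x))\<^sup>2 = (cmod (f x))\<^sup>2 - 2 * r x + (cmod (g x))\<^sup>2" for x
    unfolding cmod_power2 r_def by (simp add: power2_eq_square algebra_simps)
  have i: "integrable M (\<lambda>x. cnj (f x) * g x)"
    using assms by (intro integrable_cnj_mult)
  have "integrable M r"
    unfolding r_def using i by (rule integrable_Re)
  moreover have "Re (sq_inner M f g) = integral\<^sup>L M r"
    unfolding sq_inner_def r_def using i by (rule integral_Re[symmetric])
  moreover have "integrable M (\<lambda>x. (cmod (f x))\<^sup>2)" "integrable M (\<lambda>x. (cmod (g x))\<^sup>2)"
    using assms by (auto simp: sq_integrable_def)
  ultimately show ?thesis
    unfolding sq_norm2_def * by simp
qed

text \<open>A triangle inequality for squared norms, obtained pointwise from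
  \<open>cmod_add_sq_le\<close>. The factors 2 are harmless where only smallness matters.\<close>

lemma sq_norm2_diff_le:
  assumes "f \<in> sq_integrable M" "g \<in> sq_integrable M" "h \<in> sq_integrable M"
  shows "sq_norm2 M (\<lambda>x. f x - h x)
    \<le> 2 * sq_norm2 M (\<lambda>x. f x - g x) + 2 * sq_norm2 M (\<lambda>x. g x - h x)"
proof -
  have fg: "integrable M (\<lambda>x. (cmod (f x - g x))\<^sup>2)"
    and gh: "integrable M (\<lambda>x. (cmod (g x - h x))\<^sup>2)"
    and fh: "integrable M (\<lambda>x. (cmod (f x - h x))\<^sup>2)"
    using assms sq_integrable_diff[of _ M] by (auto simp: sq_integrable_def)
  have "sq_norm2 M (\<lambda>x. f x - h x)
    \<le> (LINT x|M. 2 * (cmod (f x - g x))\<^sup>2 + 2 * (cmod (g x - h x))\<^sup>2)"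
    unfolding sq_norm2_def
    using cmod_add_sq_le[of "f x - g x" "g x - h x" for x]
    by (intro integral_mono fh) (auto intro!: Bochner_Integration.integrable_add integrable_mult_right fg gh)
  also have "\<dots> = 2 * sq_norm2 M (\<lambda>x. f x - g x) + 2 * sq_norm2 M (\<lambda>x. g x - h x)"
    unfolding sq_norm2_def using fg gh by simp
  finally show ?thesis .
qed

section \<open>Reconstruction from a tight frame, and Parseval for complete orthonormal
  families\<close>

text \<open>Let s be the partial sum over F and b the sum of the squared coefficient moduli over F.
  Then the inner product of f and s is b / K, and the squared norm of s is at most b / K, so
  expanding the square bounds the squared error by \<open>sq_norm2 M f - b / K\<close>. This tends
  to 0 by Parseval along all finite sets, hence the convergence is unconditional.\<close>

theorem tight_frame_expansion:
  assumes v: "\<And>i. i \<in> I \<Longrightarrow> v i \<in> sq_integrable M" and K: "K > 0"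
    and parseval: "\<And>g. g \<in> sq_integrable M \<Longrightarrow>
      ((\<lambda>i. (cmod (sq_inner M (v i) g))\<^sup>2) has_sum (K * sq_norm2 M g)) I"
    and f: "f \<in> sq_integrable M"
  shows "((\<lambda>F. sq_norm2 M (\<lambda>x. f x - (\<Sum>i\<in>F. (sq_inner M (v i) f / of_real K) * v i x))) \<longlongrightarrow> 0)
           (finite_subsets_at_top I)"
proof (rule tendsto_sandwich[where f = "\<lambda>_. 0"
      and h = "\<lambda>F. sq_norm2 M f - (\<Sum>i\<in>F. (cmod (sq_inner M (v i) f))\<^sup>2) / K"])
  let ?c = "\<lambda>i. sq_inner M (v i) f"
  let ?s = "\<lambda>F x. \<Sum>i\<in>F. (?c i / of_real K) * v i x"
  let ?b = "\<lambda>F. \<Sum>i\<in>F. (cmod (?c i))\<^sup>2"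
  show "((\<lambda>F. sq_norm2 M f - ?b F / K) \<longlongrightarrow> 0) (finite_subsets_at_top I)"
  proof -
    have "(?b \<longlongrightarrow> K * sq_norm2 M f) (finite_subsets_at_top I)"
      using parseval[OF f] by (simp add: has_sum_def)
    then have "((\<lambda>F. sq_norm2 M f - ?b F / K) \<longlongrightarrow> sq_norm2 M f - K * sq_norm2 M f / K)
        (finite_subsets_at_top I)"
      using K by (intro tendsto_intros) auto
    then show ?thesis using K by simp
  qed
  have "sq_norm2 M (\<lambda>x. f x - ?s F x) \<le> sq_norm2 M f - ?b F / K" if F: "finite F" "F \<subseteq> I" for F
  proof -
    have vF: "i \<in> F \<Longrightarrow> v i \<in> sq_integrable M" for i using v F by auto
    have s: "?s F \<in> sq_integrable M" by (intro sq_integrable_sum vF)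
    have "sq_inner M f (?s F) = (\<Sum>i\<in>F. (?c i / of_real K) * cnj (?c i))"
      unfolding sq_inner_cnj by (rule sq_inner_sum) (use vF f in auto)
    also have "\<dots> = (\<Sum>i\<in>F. of_real ((cmod (?c i))\<^sup>2) / of_real K)"
      unfolding complex_norm_square by simp
    also have "\<dots> = of_real (?b F / K)"
      by (simp add: sum_divide_distrib)
    finally have "sq_inner M f (?s F) = of_real (?b F / K)" .
    then have inner: "Re (sq_inner M f (?s F)) = ?b F / K" by simp
    \<comment> \<open>Testing \<open>?s F\<close> against itself and using Parseval for it bounds its norm.\<close>
    have "of_real (sq_norm2 M (?s F)) = (\<Sum>i\<in>F. (?c i / of_real K) * sq_inner M (?s F) (v i))"
      unfolding sq_inner_self[symmetric] by (rule sq_inner_sum) (use vF s in auto)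
    from arg_cong[OF this, of cmod]
    have "sq_norm2 M (?s F) = cmod (\<Sum>i\<in>F. (?c i / of_real K) * sq_inner M (?s F) (v i))"
      unfolding norm_of_real abs_of_nonneg[OF sq_norm2_nonneg] .
    also have "\<dots> \<le> (\<Sum>i\<in>F. cmod ((?c i / of_real K) * sq_inner M (?s F) (v i)))"
      by (rule norm_sum)
    also have "\<dots> \<le> (\<Sum>i\<in>F. ((cmod (?c i))\<^sup>2 + (cmod (sq_inner M (v i) (?s F)))\<^sup>2) / (2 * K))"
    proof (rule sum_mono)
      fix i
      have "2 * cmod (?c i) * cmod (sq_inner M (v i) (?s F))
          \<le> (cmod (?c i))\<^sup>2 + (cmod (sq_inner M (v i) (?s F)))\<^sup>2"
        by (rule sum_squares_bound)
      moreover have "cmod (sq_inner M (?s F) (v i)) = cmod (sq_inner M (v i) (?s F))"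
        by (subst sq_inner_cnj[symmetric]) simp
      ultimately show "cmod ((?c i / of_real K) * sq_inner M (?s F) (v i))
          \<le> ((cmod (?c i))\<^sup>2 + (cmod (sq_inner M (v i) (?s F)))\<^sup>2) / (2 * K)"
        using K by (simp add: norm_mult norm_divide field_simps)
    qed
    also have "\<dots> = (?b F + (\<Sum>i\<in>F. (cmod (sq_inner M (v i) (?s F)))\<^sup>2)) / (2 * K)"
      by (simp add: sum.distrib flip: sum_divide_distrib)
    also have "\<dots> \<le> (?b F + K * sq_norm2 M (?s F)) / (2 * K)"
      using K by (intro divide_right_mono add_left_mono finite_sum_le_has_sum[OF parseval[OF s]] F) auto
    \<comment> \<open>The chain bounds the squared norm S of the partial sum by (b + K S) / (2 K);
      absorbing S / 2 into the left side leaves S \<le> b / K.\<close>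
    finally have "sq_norm2 M (?s F) \<le> ?b F / K"
      using K by (simp add: field_simps)
    then show ?thesis
      unfolding sq_norm2_diff[OF f s] inner by simp
  qed
  then show "\<forall>\<^sub>F F in finite_subsets_at_top I. sq_norm2 M (\<lambda>x. f x - ?s F x) \<le> sq_norm2 M f - ?b F / K"
    by (auto intro!: eventually_finite_subsets_at_top_weakI)
qed (auto simp: sq_norm2_nonneg)

text \<open>Completing the square (\<open>dist\<close>) splits the squared error of any finite
  combination into the defect in Bessel's inequality and the squared distance of its coefficients
  from the Fourier coefficients. Good approximants therefore force the defect to 0.\<close>

theorem orthonormal_parseval:
  assumes e: "\<And>i. e i \<in> sq_integrable M"
    and orth: "\<And>i j. sq_inner M (e i) (e j) = of_bool (i = j)"
    and h: "h \<in> sq_integrable M"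
    and approx: "\<And>\<delta>. \<delta> > 0 \<Longrightarrow>
      \<exists>F c. finite F \<and> sq_norm2 M (\<lambda>x. h x - (\<Sum>i\<in>F. c i * e i x)) < \<delta>"
  shows "((\<lambda>i. (cmod (sq_inner M (e i) h))\<^sup>2) has_sum (sq_norm2 M h)) UNIV"
proof -
  let ?a = "\<lambda>i. (cmod (sq_inner M (e i) h))\<^sup>2"
  have dist: "sq_norm2 M (\<lambda>x. h x - (\<Sum>i\<in>F. c i * e i x))
      = sq_norm2 M h - sum ?a F + (\<Sum>i\<in>F. (cmod (c i - sq_inner M (e i) h))\<^sup>2)"
    if F: "finite F" for F c
  proof -
    let ?s = "\<lambda>x. \<Sum>i\<in>F. c i * e i x"
    have s: "?s \<in> sq_integrable M" by (intro sq_integrable_sum e)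
    have es: "sq_inner M (e i) ?s = c i" if "i \<in> F" for i
    proof -
      have "sq_inner M (e i) ?s = (\<Sum>j\<in>F. if i = j then c j else 0)"
        by (subst sq_inner_sum) (auto simp: e orth intro!: sum.cong)
      then show ?thesis using that F by (simp add: sum.delta)
    qed
    have "complex_of_real (sq_norm2 M ?s) = (\<Sum>i\<in>F. c i * sq_inner M ?s (e i))"
      unfolding sq_inner_self[symmetric] by (rule sq_inner_sum) (use e s in auto)
    also have "\<dots> = (\<Sum>i\<in>F. c i * cnj (c i))"
      by (intro sum.cong refl) (simp only: es sq_inner_cnj[of M _ ?s, symmetric])
    also have "\<dots> = of_real (\<Sum>i\<in>F. (cmod (c i))\<^sup>2)"
      unfolding of_real_sum complex_norm_square ..
    finally have "complex_of_real (sq_norm2 M ?s) = of_real (\<Sum>i\<in>F. (cmod (c i))\<^sup>2)" .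
    then have n: "sq_norm2 M ?s = (\<Sum>i\<in>F. (cmod (c i))\<^sup>2)"
      using of_real_eq_iff by blast
    define r where "r i = Re (c i * cnj (sq_inner M (e i) h))" for i
    have i: "Re (sq_inner M h ?s) = sum r F"
      unfolding sq_inner_sum[OF e h] Re_sum r_def sq_inner_cnj ..
    have *: "(cmod (c i - sq_inner M (e i) h))\<^sup>2 = (cmod (c i))\<^sup>2 - 2 * r i + ?a i" for i
      unfolding cmod_power2 r_def by (simp add: power2_eq_square algebra_simps)
    show ?thesis
      unfolding sq_norm2_diff[OF h s] n i *
      by (simp add: sum.distrib sum_subtractf flip: sum_distrib_left)
  qed
  \<comment> \<open>With the Fourier coefficients as \<open>c\<close> the last sum in
    \<open>dist\<close> vanishes, which gives Bessel's inequality.\<close>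
  have le: "sum ?a F \<le> sq_norm2 M h" if "finite F" for F
    using dist[OF that, of "\<lambda>i. sq_inner M (e i) h"]
      sq_norm2_nonneg[of M "\<lambda>x. h x - (\<Sum>i\<in>F. sq_inner M (e i) h * e i x)"] by simp
  show ?thesis
    unfolding has_sum_def
  proof (rule order_tendstoI)
    \<comment> \<open>An approximant with squared error below \<open>sq_norm2 M h - y\<close>
      already pushes the sum over its index set F above y; larger sets only add nonnegative
      terms.\<close>
    fix y assume "y < sq_norm2 M h"
    then obtain F c where F: "finite F"
      and d: "sq_norm2 M (\<lambda>x. h x - (\<Sum>i\<in>F. c i * e i x)) < sq_norm2 M h - y"
      using approx[of "sq_norm2 M h - y"] by auto
    have "sq_norm2 M h - sum ?a F \<le> sq_norm2 M (\<lambda>x. h x - (\<Sum>i\<in>F. c i * e i x))"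
      using dist[OF F, of c] by (simp add: sum_nonneg)
    then have "y < sum ?a F" using d by simp
    then show "\<forall>\<^sub>F F in finite_subsets_at_top UNIV. y < sum ?a F"
      unfolding eventually_finite_subsets_at_top
      using F by (intro exI[of _ F]) (auto elim!: less_le_trans intro!: sum_mono2)
  next
    fix y assume "sq_norm2 M h < y"
    then show "\<forall>\<^sub>F F in finite_subsets_at_top UNIV. sum ?a F < y"
      by (intro eventually_finite_subsets_at_top_weakI) (rule le_less_trans[OF le])
  qed
qed

section \<open>Fourier series with respect to a phase function\<close>

text \<open>The variable t counts full turns, so the period is 1. Generating the class from
  monomials and sums reduces closure under products to the product of two monomials.\<close>

inductive trig_poly :: "(real \<Rightarrow> complex) \<Rightarrow> bool" where
  monomial: "trig_poly (\<lambda>t. c * cis (2 * pi * of_int m * t))"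
| add: "trig_poly p \<Longrightarrow> trig_poly q \<Longrightarrow> trig_poly (\<lambda>t. p t + q t)"

lemma trig_poly_const: "trig_poly (\<lambda>_. c)"
  using trig_poly.monomial[of c 0] by simp

lemma trig_poly_monomial_mult:
  assumes "trig_poly p"
  shows "trig_poly (\<lambda>t. c * cis (2 * pi * of_int m * t) * p t)"
  using assms
proof induction
  case (monomial d k)
  have "(\<lambda>t. c * cis (2 * pi * of_int m * t) * (d * cis (2 * pi * of_int k * t)))
      = (\<lambda>t. (c * d) * cis (2 * pi * of_int (m + k) * t))"
    by (simp add: fun_eq_iff algebra_simps flip: cis_mult)
  then show ?case by (metis trig_poly.monomial)
next
  case (add p q)
  then show ?case by (simp add: distrib_left trig_poly.add)
qed

lemma trig_poly_mult:
  assumes "trig_poly p" "trig_poly q"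
  shows "trig_poly (\<lambda>t. p t * q t)"
  using assms(1)
proof induction
  case (monomial c m)
  then show ?case using assms(2) by (rule trig_poly_monomial_mult)
next
  case (add p p')
  then show ?case by (simp add: distrib_right trig_poly.add)
qed

text \<open>Polynomial functions are generated by linear ones, constants, sums and products, so only
  the linear case requires a computation on the circle.\<close>

lemma trig_poly_real_polynomial_function:
  assumes "real_polynomial_function p"
  shows "trig_poly (\<lambda>t. of_real (p (cis (2 * pi * t))))"
  using assms
proof induction
  case (linear f)
  define a b where "a = f 1" and "b = f \<i>"
  have f: "f z = Re z * a + Im z * b" for z
  proof -
    interpret bounded_linear f by fact
    have "f z = f (Re z *\<^sub>R 1 + Im z *\<^sub>R \<i>)"
      by (rule arg_cong[of _ _ f]) (simp add: complex_eq_iff)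
    then show ?thesis by (simp add: add scaleR a_def b_def)
  qed
  \<comment> \<open>On the circle, a Re z + b Im z is half of (a - ib) z plus its conjugate, giving
    frequencies 1 and -1.\<close>
  have "(\<lambda>t. of_real (f (cis (2 * pi * t)))) = (\<lambda>t.
      Complex (a / 2) (- b / 2) * cis (2 * pi * of_int 1 * t)
    + Complex (a / 2) (b / 2) * cis (2 * pi * of_int (-1) * t))"
    by (simp add: fun_eq_iff complex_eq_iff f field_simps)
  then show ?case
    by (simp only:) (intro trig_poly.intros)
qed (simp_all add: trig_poly_const trig_poly.add trig_poly_mult)

lemma trig_poly_polynomial_function:
  fixes p :: "complex \<Rightarrow> complex"
  assumes "polynomial_function p"
  shows "trig_poly (\<lambda>t. p (cis (2 * pi * t)))"
proof -
  have "trig_poly (\<lambda>t. of_real (Re (p (cis (2 * pi * t)))))"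
       "trig_poly (\<lambda>t. of_real (Im (p (cis (2 * pi * t)))))"
    using assms bounded_linear_Re bounded_linear_Im
      trig_poly_real_polynomial_function[of "Re \<circ> p"] trig_poly_real_polynomial_function[of "Im \<circ> p"]
    by (auto simp: polynomial_function_def)
  then have "trig_poly (\<lambda>t. of_real (Re (p (cis (2 * pi * t)))) + \<i> * of_real (Im (p (cis (2 * pi * t)))))"
    by (intro trig_poly.add trig_poly_mult trig_poly_const)
  then show ?thesis by (simp flip: complex_eq)
qed

lemma trig_poly_expansion:
  assumes "trig_poly p"
  obtains F c where "finite F" "p = (\<lambda>t. \<Sum>m\<in>F. c m * cis (2 * pi * of_int m * t))"
  using assms
proof (induction arbitrary: thesis)
  case (monomial c m)
  show ?case by (rule monomial[of "{m}" "\<lambda>_. c"]) auto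
next
  case (add p q)
  obtain F c where F: "finite F" "p = (\<lambda>t. \<Sum>m\<in>F. c m * cis (2 * pi * of_int m * t))"
    using add.IH(1) by blast
  obtain G d where G: "finite G" "q = (\<lambda>t. \<Sum>m\<in>G. d m * cis (2 * pi * of_int m * t))"
    using add.IH(2) by blast
  have "(\<Sum>m\<in>F. c m * cis (2 * pi * of_int m * t)) = (\<Sum>m\<in>F \<union> G. (if m \<in> F then c m else 0) * cis (2 * pi * of_int m * t))"
    and "(\<Sum>m\<in>G. d m * cis (2 * pi * of_int m * t)) = (\<Sum>m\<in>F \<union> G. (if m \<in> G then d m else 0) * cis (2 * pi * of_int m * t))" for t
    using F(1) G(1) by (auto intro!: sum.mono_neutral_cong_left)
  then show ?case
    using F G by (intro add.prems[of "F \<union> G" "\<lambda>m. (if m \<in> F then c m else 0) + (if m \<in> G then d m else 0)"])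
      (simp_all add: sum.distrib distrib_right fun_eq_iff)
qed

section \<open>Orthonormal exponentials attached to a phase function\<close>

text \<open>\<open>winding\<close> and monotonicity make \<open>cis (2 * pi * \<phi> x)\<close> run
  exactly once round the circle as x goes from \<alpha> to \<beta>. The smoothness and positivity
  conditions hold on the whole line, which makes the locale stable under translation.\<close>

locale phase_function =
  fixes \<phi> \<phi>' :: "real \<Rightarrow> real" and \<alpha> \<beta> :: real
  assumes interval: "\<alpha> < \<beta>"
    and deriv: "\<And>x. (\<phi> has_real_derivative \<phi>' x) (at x)"
    and cont': "continuous_on UNIV \<phi>'"
    and pos: "\<And>x. \<phi>' x > 0"
    and winding: "\<phi> \<beta> - \<phi> \<alpha> = 1"
begin

definition weight :: "real \<Rightarrow> real" where
  "weight x = indicator {\<alpha>..\<beta>} x * \<phi>' x"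

text \<open>A probability measure whose image under \<phi> is Lebesgue measure on an interval of
  length one. Being a density, it keeps Lebesgue measurability.\<close>

definition M :: "real measure" where
  "M = density lebesgue (\<lambda>x. ennreal (weight x))"

definition E :: "int \<Rightarrow> real \<Rightarrow> complex" where
  "E m x = cis (2 * pi * of_int m * \<phi> x)"

lemma weight_nonneg: "0 \<le> weight x"
  using pos[of x] by (simp add: weight_def)

lemma weight_borel [measurable]: "weight \<in> borel_measurable borel"
  unfolding weight_def[abs_def]
  by (intro borel_measurable_times borel_measurable_indicator borel_measurable_continuous_onI cont') simp

lemma weight_lebesgue [measurable]: "weight \<in> borel_measurable lebesgue"
  by (rule measurable_completion) simp

lemma cont: "continuous_on S \<phi>"
  using deriv by (meson DERIV_isCont continuous_at_imp_continuous_on)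

lemma strict_mono: "x < y \<Longrightarrow> \<phi> x < \<phi> y"
  by (rule DERIV_pos_imp_increasing) (use deriv pos in blast)+

lemma measurable_M [simp]: "borel_measurable M = borel_measurable lebesgue"
  unfolding M_def by (rule measurable_cong_sets) auto

lemma integral_M:
  fixes f :: "real \<Rightarrow> 'b::{banach, second_countable_topology}"
  assumes "f \<in> borel_measurable lebesgue"
  shows "integral\<^sup>L M f = (LINT x|lebesgue. weight x *\<^sub>R f x)"
  unfolding M_def by (rule integral_density) (use assms weight_nonneg in auto)

lemma integrable_M:
  fixes f :: "real \<Rightarrow> 'b::{banach, second_countable_topology}"
  assumes "f \<in> borel_measurable lebesgue"
  shows "integrable M f \<longleftrightarrow> integrable lebesgue (\<lambda>x. weight x *\<^sub>R f x)"
  unfolding M_def by (rule integrable_density) (use assms weight_nonneg in auto)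

text \<open>As \<phi>' is positive everywhere, the weight is positive exactly on the
  interval.\<close>

lemma AE_M_iff: "(AE x in M. P x) \<longleftrightarrow> (AE x in lebesgue. x \<in> {\<alpha>..\<beta>} \<longrightarrow> P x)"
proof -
  have "0 < weight x \<longleftrightarrow> x \<in> {\<alpha>..\<beta>}" for x
    using pos[of x] by (simp add: weight_def indicator_def)
  then show ?thesis unfolding M_def by (subst AE_density) auto
qed

lemma AE_M_interval: "AE x in M. x \<in> {\<alpha><..<\<beta>}"
proof -
  have "AE x in lebesgue. x \<noteq> \<alpha>" "AE x in lebesgue. x \<noteq> \<beta>"
    using AE_lborel_singleton by (auto intro!: AE_completion)
  then show ?thesis unfolding AE_M_iff by eventually_elim auto
qed

text \<open>This replaces the substitution t = \<phi> x: an antiderivative of \<phi>' f evaluates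
  the integral directly. The fundamental theorem is applied over Borel sets, and continuity of f
  lets the result pass to the completion.\<close>

lemma integral_M_FTC:
  fixes f F :: "real \<Rightarrow> 'b::euclidean_space"
  assumes f: "continuous_on UNIV f"
    and F: "\<And>x. (F has_vector_derivative \<phi>' x *\<^sub>R f x) (at x)"
  shows "integrable M f" "integral\<^sup>L M f = F \<beta> - F \<alpha>"
proof -
  have fb: "f \<in> borel_measurable borel"
    using f by (rule borel_measurable_continuous_onI)
  then have fl: "f \<in> borel_measurable lebesgue"
    by (intro measurable_completion) simp
  have wb: "(\<lambda>x. weight x *\<^sub>R f x) \<in> borel_measurable lborel"
    using fb by simp
  have w: "(\<lambda>x. weight x *\<^sub>R f x) = (\<lambda>x. indicator {\<alpha>..\<beta>} x *\<^sub>R (\<phi>' x *\<^sub>R f x))"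
    by (simp add: weight_def)
  have "has_bochner_integral lborel (\<lambda>x. weight x *\<^sub>R f x) (F \<beta> - F \<alpha>)"
    unfolding w
  proof (rule has_bochner_integral_FTC_Icc)
    show "(F has_vector_derivative \<phi>' x *\<^sub>R f x) (at x within {\<alpha>..\<beta>})" for x
      using F by (rule has_vector_derivative_at_within)
    have "continuous_on UNIV (\<lambda>x. \<phi>' x *\<^sub>R f x)"
      using cont' f by (rule continuous_on_scaleR)
    then show "continuous_on {\<alpha>..\<beta>} (\<lambda>x. \<phi>' x *\<^sub>R f x)"
      by (rule continuous_on_subset) simp
  qed (use interval in simp)
  then show "integrable M f" "integral\<^sup>L M f = F \<beta> - F \<alpha>"
    unfolding integrable_M[OF fl] integral_M[OF fl] integral_completion[OF wb] integrable_completion[OF wb]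
    by (auto simp: has_bochner_integral_iff)
qed

lemma integrable_M_const: "integrable M (\<lambda>_. c :: real)"
  and integral_M_const: "(LINT x|M. c :: real) = c"
proof -
  have *: "((\<lambda>x. c * \<phi> x) has_vector_derivative \<phi>' x *\<^sub>R c) (at x)" for x
    using DERIV_cmult[OF deriv, of c]
    by (simp add: has_real_derivative_iff_has_vector_derivative mult.commute)
  show "integrable M (\<lambda>_. c)" "(LINT x|M. c) = c"
    using integral_M_FTC[OF _ *] winding by (auto simp flip: right_diff_distrib)
qed

text \<open>For nonzero k the antiderivative
  \<open>cis (2 * pi * k * \<phi> x) / (2 * pi * \<i> * k)\<close> takes equal values at both end
  points, where the phases differ by k full turns.\<close>

lemma integral_M_cis: "(LINT x|M. cis (2 * pi * of_int k * \<phi> x)) = of_bool (k = 0)"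
proof (cases "k = 0")
  case True
  have "((\<lambda>x. complex_of_real (\<phi> x)) has_vector_derivative \<phi>' x *\<^sub>R 1) (at x)" for x
    using has_vector_derivative_of_real[OF deriv[of x]]
    by (simp add: scaleR_conv_of_real)
  from integral_M_FTC(2)[OF _ this] have "(LINT x|M. (1::complex)) = of_real (\<phi> \<beta> - \<phi> \<alpha>)"
    by simp
  then show ?thesis using True winding by simp
next
  case False
  let ?c = "2 * pi * of_int k"
  let ?F = "\<lambda>x. cis (?c * \<phi> x) / (\<i> * of_real ?c)"
  have "(?F has_vector_derivative \<phi>' x *\<^sub>R cis (?c * \<phi> x)) (at x)" for x
  proof -
    have "((\<lambda>z. exp (\<i> * of_real ?c * z) / (\<i> * of_real ?c)) has_field_derivative
        exp (\<i> * of_real ?c * z)) (at z)" for z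
      using False by (auto intro!: derivative_eq_intros)
    from field_vector_diff_chain_at[OF has_vector_derivative_of_real[OF deriv[of x]] this]
    have "((\<lambda>x. exp (\<i> * of_real ?c * of_real (\<phi> x)) / (\<i> * of_real ?c)) has_vector_derivative
        of_real (\<phi>' x) * exp (\<i> * of_real ?c * of_real (\<phi> x))) (at x)"
      by (simp only: o_def)
    then show ?thesis by (simp add: cis_conv_exp scaleR_conv_of_real mult_ac)
  qed
  moreover have "continuous_on UNIV (\<lambda>x. cis (?c * \<phi> x))"
    by (intro continuous_intros cont)
  ultimately have "(LINT x|M. cis (?c * \<phi> x)) = ?F \<beta> - ?F \<alpha>"
    by (intro integral_M_FTC)
  also have "\<dots> = 0"
  proof -
    have "?c * \<phi> \<beta> = ?c * \<phi> \<alpha> + 2 * pi * of_int k"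
      using winding by (simp add: algebra_simps)
    then have "cis (?c * \<phi> \<beta>) = cis (?c * \<phi> \<alpha>)"
      by (simp only: cis_mult[symmetric] cis_multiple_2pi[OF Ints_of_int] mult_1_right)
    then show ?thesis
      by simp
  qed
  finally show ?thesis using False by simp
qed

lemma E_cont: "continuous_on UNIV (E m)"
  unfolding E_def[abs_def] by (intro continuous_intros cont)

lemma sq_integrable_bounded:
  assumes "f \<in> borel_measurable lebesgue" "\<And>x. x \<in> {\<alpha>..\<beta>} \<Longrightarrow> cmod (f x) \<le> C"
  shows "f \<in> sq_integrable M"
proof (rule sq_integrable_bound)
  show "AE x in M. (cmod (f x))\<^sup>2 \<le> C\<^sup>2"
    using assms(2) by (auto simp: AE_M_iff intro!: power_mono)
qed (use assms(1) integrable_M_const in auto)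

lemma sq_norm2_le:
  assumes f: "f \<in> sq_integrable M" and bound: "\<And>x. x \<in> {\<alpha>..\<beta>} \<Longrightarrow> cmod (f x) \<le> C"
  shows "sq_norm2 M f \<le> C\<^sup>2"
proof -
  have "sq_norm2 M f \<le> (LINT x|M. C\<^sup>2)"
    unfolding sq_norm2_def
  proof (rule integral_mono_AE)
    show "AE x in M. (cmod (f x))\<^sup>2 \<le> C\<^sup>2"
      using bound by (auto simp: AE_M_iff intro!: power_mono)
  qed (use f integrable_M_const in \<open>auto simp: sq_integrable_def\<close>)
  then show ?thesis by (simp only: integral_M_const)
qed

lemma continuous_measurable_lebesgue:
  "continuous_on UNIV f \<Longrightarrow> f \<in> borel_measurable (lebesgue :: real measure)"
  by (intro measurable_completion) (simp add: borel_measurable_continuous_onI)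

lemma E_sq_integrable: "E m \<in> sq_integrable M"
  by (rule sq_integrable_bounded[of _ 1])
     (auto simp: E_def intro: continuous_measurable_lebesgue E_cont)

lemma E_orthonormal: "sq_inner M (E i) (E j) = of_bool (i = j)"
proof -
  have "cnj (E i x) * E j x = cis (2 * pi * of_int (j - i) * \<phi> x)" for x
    by (simp add: E_def cis_cnj cis_mult algebra_simps)
  then show ?thesis unfolding sq_inner_def by (simp only: integral_M_cis) auto
qed

section \<open>Density of trigonometric polynomials in the phase\<close>

lemma trig_poly_cont: "trig_poly p \<Longrightarrow> continuous_on UNIV (\<lambda>x. p (\<phi> x))"
  by (induction rule: trig_poly.induct) (auto intro!: continuous_intros cont)

lemma continuous_sq_integrable:
  assumes "continuous_on UNIV f"
  shows "f \<in> sq_integrable M"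
proof -
  have "compact (f ` {\<alpha>..\<beta>})"
    using assms by (intro compact_continuous_image) (auto intro: continuous_on_subset)
  then obtain C where "\<And>x. x \<in> {\<alpha>..\<beta>} \<Longrightarrow> cmod (f x) \<le> C"
    by (meson bounded_iff compact_imp_bounded imageI)
  then show ?thesis
    by (rule sq_integrable_bounded[OF continuous_measurable_lebesgue[OF assms]])
qed

text \<open>Equal values on the circle mean that the phases differ by an integer. It is positive by
  strict monotonicity, hence at least 1, which is the whole increase over the interval; so x and y
  exhaust it.\<close>

lemma cis_phase_eq:
  assumes "x \<in> {\<alpha>..\<beta>}" "y \<in> {\<alpha>..\<beta>}" "x < y" "cis (2 * pi * \<phi> x) = cis (2 * pi * \<phi> y)"
  shows "x = \<alpha>" "y = \<beta>"
proof -
  have "cis (2 * pi * (\<phi> y - \<phi> x)) = 1"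
    unfolding right_diff_distrib cis_divide[symmetric] assms(4) by simp
  then have "cos (2 * pi * (\<phi> y - \<phi> x)) = 1"
    by (metis cis.sel(1) one_complex.sel(1))
  then obtain n :: int where "2 * pi * (\<phi> y - \<phi> x) = of_int n * 2 * pi"
    using cos_one_2pi_int by blast
  then have n: "\<phi> y - \<phi> x = of_int n" by simp
  have "\<phi> x < \<phi> y" using strict_mono assms by blast
  then have "of_int n > (0::real)" using n by linarith
  then have "of_int n \<ge> (1::real)" by simp
  then have ge: "\<phi> y - \<phi> x \<ge> 1" using n by simp
  have "\<alpha> < x \<Longrightarrow> \<phi> \<alpha> < \<phi> x" "y < \<beta> \<Longrightarrow> \<phi> y < \<phi> \<beta>" by (auto intro: strict_mono)
  moreover have "\<phi> \<alpha> \<le> \<phi> x" "\<phi> y \<le> \<phi> \<beta>"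
    using strict_mono assms(1,2) by (auto simp: less_eq_real_def)
  ultimately show "x = \<alpha>" "y = \<beta>"
    using ge winding assms(1,2) by force+
qed

text \<open>Stone-Weierstrass on the image circle: a polynomial in the plane, restricted to the
  circle, is a trigonometric polynomial in the phase.\<close>

lemma trig_poly_uniform_approx:
  fixes g :: "real \<Rightarrow> complex"
  assumes g: "continuous_on {\<alpha>..\<beta>} g" "g \<alpha> = g \<beta>" and d: "\<delta> > 0"
  shows "\<exists>p. trig_poly p \<and> (\<forall>x\<in>{\<alpha>..\<beta>}. cmod (g x - p (\<phi> x)) < \<delta>)"
proof -
  define \<kappa> where "\<kappa> x = cis (2 * pi * \<phi> x)" for x
  \<comment> \<open>As \<open>g \<alpha> = g \<beta>\<close>, \<open>g\<close> factors through the circle as \<open>g = G \<circ> \<kappa>\<close>; \<open>G\<close> is continuous because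
    \<open>\<kappa>\<close> maps compact sets to closed ones.\<close>
  define G where "G z = g (inv_into {\<alpha>..\<beta>} \<kappa> z)" for z
  have inj: "g x = g y" if "x \<in> {\<alpha>..\<beta>}" "y \<in> {\<alpha>..\<beta>}" "\<kappa> x = \<kappa> y" for x y
    using cis_phase_eq[of x y] cis_phase_eq[of y x] that g(2)
    by (cases x y rule: linorder_cases) (auto simp: \<kappa>_def)
  have G: "G (\<kappa> x) = g x" if "x \<in> {\<alpha>..\<beta>}" for x
    unfolding G_def using that
    by (intro inj inv_into_into f_inv_into_f imageI)
  have cont_\<kappa>: "continuous_on S \<kappa>" for S
    unfolding \<kappa>_def[abs_def] by (intro continuous_intros cont)
  have compact: "compact (\<kappa> ` {\<alpha>..\<beta>})"
    using cont_\<kappa> by (intro compact_continuous_image) auto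
  have "closed (G -` B \<inter> \<kappa> ` {\<alpha>..\<beta>})" if "closed B" for B
  proof -
    have "closed (g -` B \<inter> {\<alpha>..\<beta>})"
      using g(1) that by (simp add: continuous_on_closed_vimage)
    then have "compact (g -` B \<inter> {\<alpha>..\<beta>})"
      by (simp add: compact_eq_bounded_closed bounded_Int)
    then have "closed (\<kappa> ` (g -` B \<inter> {\<alpha>..\<beta>}))"
      using cont_\<kappa> by (intro compact_imp_closed compact_continuous_image) auto
    also have "\<kappa> ` (g -` B \<inter> {\<alpha>..\<beta>}) = G -` B \<inter> \<kappa> ` {\<alpha>..\<beta>}"
      using G by (auto simp del: atLeastAtMost_iff)
    finally show ?thesis .
  qed
  then have "continuous_on (\<kappa> ` {\<alpha>..\<beta>}) G"
    using compact_imp_closed[OF compact] by (simp add: continuous_on_closed_vimage)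
  from Stone_Weierstrass_polynomial_function[OF compact this d]
  obtain P where P: "polynomial_function P" "\<And>z. z \<in> \<kappa> ` {\<alpha>..\<beta>} \<Longrightarrow> cmod (G z - P z) < \<delta>"
    by blast
  show ?thesis
  proof (intro exI conjI ballI)
    show "trig_poly (\<lambda>t. P (cis (2 * pi * t)))"
      using P(1) by (rule trig_poly_polynomial_function)
    fix x assume x: "x \<in> {\<alpha>..\<beta>}"
    then show "cmod (g x - P (cis (2 * pi * \<phi> x))) < \<delta>"
      using P(2)[of "\<kappa> x"] G[OF x] by (simp add: \<kappa>_def)
  qed
qed

text \<open>Density in mean square is proved in three stages: continuous functions with equal end
  values, then bounded measurable functions, then all of \<open>sq_integrable M\<close>.\<close>

definition trig_approximable :: "(real \<Rightarrow> complex) \<Rightarrow> bool" where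
  "trig_approximable h \<longleftrightarrow>
     (\<forall>\<delta>>0. \<exists>p. trig_poly p \<and> sq_norm2 M (\<lambda>x. h x - p (\<phi> x)) < \<delta>)"

lemma trig_approximable_continuous:
  assumes g: "continuous_on UNIV g" "g \<alpha> = g \<beta>"
  shows "trig_approximable g"
  unfolding trig_approximable_def
proof (intro allI impI)
  fix \<delta> :: real assume d: "\<delta> > 0"
  \<comment> \<open>Since M has mass 1, a uniform error of \<open>sqrt (\<delta> / 2)\<close> gives
    a squared norm of at most \<delta> / 2.\<close>
  then obtain p where p: "trig_poly p" "\<And>x. x \<in> {\<alpha>..\<beta>} \<Longrightarrow> cmod (g x - p (\<phi> x)) < sqrt (\<delta> / 2)"
    using trig_poly_uniform_approx[of g "sqrt (\<delta> / 2)"] g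
    by (metis continuous_on_subset half_gt_zero real_sqrt_gt_zero subset_UNIV)
  have "sq_norm2 M (\<lambda>x. g x - p (\<phi> x)) \<le> (sqrt (\<delta> / 2))\<^sup>2"
    using p g(1) by (intro sq_norm2_le continuous_sq_integrable continuous_intros trig_poly_cont) (auto intro: less_imp_le)
  then show "\<exists>p. trig_poly p \<and> sq_norm2 M (\<lambda>x. g x - p (\<phi> x)) < \<delta>"
    using p(1) d by (intro exI[of _ p]) auto
qed

lemma trig_approximable_limit:
  assumes u: "\<And>n. trig_approximable (u n)" "\<And>n. u n \<in> sq_integrable M"
    and h: "h \<in> sq_integrable M" and w: "integrable M w"
    and bound: "\<And>n. AE x in M. (cmod (h x - u n x))\<^sup>2 \<le> w x"
    and lim: "AE x in M. (\<lambda>n. u n x) \<longlonglongrightarrow> h x"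
  shows "trig_approximable h"
  unfolding trig_approximable_def
proof (intro allI impI)
  fix \<delta> :: real assume d: "\<delta> > 0"
  have "(\<lambda>n. LINT x|M. (cmod (h x - u n x))\<^sup>2) \<longlonglongrightarrow> (LINT x|M. 0)"
  proof (rule integral_dominated_convergence[OF _ _ w])
    show "AE x in M. (\<lambda>n. (cmod (h x - u n x))\<^sup>2) \<longlonglongrightarrow> 0"
      using lim
    proof eventually_elim
      case (elim x)
      then have "(\<lambda>n. (cmod (h x - u n x))\<^sup>2) \<longlonglongrightarrow> (cmod (h x - h x))\<^sup>2"
        by (intro tendsto_intros)
      then show ?case by simp
    qed
  next
    fix n
    show "(\<lambda>x. (cmod (h x - u n x))\<^sup>2) \<in> borel_measurable M"
      using sq_integrable_measurable[OF h] sq_integrable_measurable[OF u(2)[of n]] by auto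
  qed (use bound in auto)
  then have "(\<lambda>n. sq_norm2 M (\<lambda>x. h x - u n x)) \<longlonglongrightarrow> 0"
    by (simp add: sq_norm2_def)
  then have "\<forall>\<^sub>F n in sequentially. sq_norm2 M (\<lambda>x. h x - u n x) < \<delta> / 4"
    using d by (intro order_tendstoD) auto
  \<comment> \<open>The bound \<delta> / 4 is used for both errors, as
    \<open>sq_norm2_diff_le\<close> doubles each of them.\<close>
  then obtain n where n: "sq_norm2 M (\<lambda>x. h x - u n x) < \<delta> / 4"
    by (auto simp: eventually_sequentially)
  obtain p where p: "trig_poly p" "sq_norm2 M (\<lambda>x. u n x - p (\<phi> x)) < \<delta> / 4"
    using u(1)[of n] d unfolding trig_approximable_def by (metis zero_less_divide_iff zero_less_numeral)
  have "sq_norm2 M (\<lambda>x. h x - p (\<phi> x)) < \<delta>"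
    using sq_norm2_diff_le[OF h u(2)[of n] continuous_sq_integrable[OF trig_poly_cont[OF p(1)]]] n p(2)
    by simp
  then show "\<exists>p. trig_poly p \<and> sq_norm2 M (\<lambda>x. h x - p (\<phi> x)) < \<delta>"
    using p(1) by blast
qed

text \<open>A Lebesgue measurable function is, off a negligible set, a pointwise limit of continuous
  functions. These are adjusted so that the continuous case and dominated convergence apply.\<close>

lemma trig_approximable_bounded:
  assumes h: "h \<in> borel_measurable lebesgue" and bound: "\<And>x. cmod (h x) \<le> N" and N: "N > 0"
  shows "trig_approximable h"
proof -
  have "h measurable_on UNIV"
    using h by (intro lebesgue_measurable_imp_measurable_on) auto
  then obtain S g where S: "negligible S" and g: "\<And>n. continuous_on UNIV (g n)"
    and lim: "\<And>x. x \<notin> S \<Longrightarrow> (\<lambda>n. g n x) \<longlonglongrightarrow> h x"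
    unfolding measurable_on_def by auto
  \<comment> \<open>\<open>clip\<close> provides the domination, \<open>cut\<close> makes the approximants vanish at both end points.\<close>
  define clip where "clip z = of_real (N / max N (cmod z)) * z" for z
  define cut where "cut n x = max 0 (min 1 (real n * ((x - \<alpha>) * (\<beta> - x))))" for n x
  define u where "u n x = of_real (cut n x) * clip (g n x)" for n x
  have clip: "cmod (clip z) \<le> N" for z
    using N by (simp add: clip_def norm_mult norm_divide field_simps)
  have clip_cont: "isCont clip z" for z
    unfolding clip_def using N by (intro continuous_intros) auto
  have cut: "0 \<le> cut n x" "cut n x \<le> 1" for n x
    by (auto simp: cut_def)
  have u_cont: "continuous_on UNIV (u n)" for n
    unfolding u_def cut_def clip_def using N by (intro continuous_intros g) (auto simp: max_def)
  have u_bound: "cmod (u n x) \<le> N" for n x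
    using mult_mono[of "cut n x" 1 "cmod (clip (g n x))" N] cut[of n x] clip[of "g n x"]
    by (simp add: u_def norm_mult)
  have hM: "h \<in> sq_integrable M"
    using h bound by (rule sq_integrable_bounded)
  show ?thesis
  proof (rule trig_approximable_limit[where u = u and w = "\<lambda>_. (2 * N)\<^sup>2"])
    show "trig_approximable (u n)" for n
      by (rule trig_approximable_continuous[OF u_cont]) (simp add: u_def cut_def)
    show "u n \<in> sq_integrable M" for n
      by (rule continuous_sq_integrable[OF u_cont])
    show "AE x in M. (cmod (h x - u n x))\<^sup>2 \<le> (2 * N)\<^sup>2" for n
    proof (intro AE_I2 power_mono)
      show "cmod (h x - u n x) \<le> 2 * N" for x
        using norm_triangle_ineq4[of "h x" "u n x"] bound[of x] u_bound[of n x] by simp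
    qed auto
    have "AE x in lebesgue. x \<notin> S"
      using S by (intro AE_not_in) (simp add: negligible_iff_null_sets)
    then have "AE x in M. x \<notin> S" unfolding AE_M_iff by eventually_elim auto
    then show "AE x in M. (\<lambda>n. u n x) \<longlonglongrightarrow> h x"
      using AE_M_interval
    proof eventually_elim
      case (elim x)
      have "(\<lambda>n. clip (g n x)) \<longlonglongrightarrow> clip (h x)"
        using lim[OF elim(1)] by (rule isCont_tendsto_compose[OF clip_cont])
      moreover have "clip (h x) = h x"
        using bound[of x] N by (simp add: clip_def)
      \<comment> \<open>In the open interval the product of the distances to the end points is
        positive, so its multiples eventually exceed 1. The end points themselves are null.\<close>
      moreover have "(\<lambda>n. cut n x) \<longlonglongrightarrow> 1"
      proof (rule tendsto_eventually)
        have *: "(x - \<alpha>) * (\<beta> - x) > 0" using elim by simp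
        then obtain K where K: "real K * ((x - \<alpha>) * (\<beta> - x)) > 1"
          using reals_Archimedean3[OF *] by blast
        have "cut n x = 1" if "n \<ge> K" for n
        proof -
          have "real n * ((x - \<alpha>) * (\<beta> - x)) \<ge> real K * ((x - \<alpha>) * (\<beta> - x))"
            using that * by (intro mult_right_mono) auto
          then show ?thesis using K by (simp add: cut_def)
        qed
        then show "\<forall>\<^sub>F n in sequentially. cut n x = 1"
          by (auto simp: eventually_sequentially)
      qed
      ultimately have "(\<lambda>n. of_real (cut n x) * clip (g n x)) \<longlonglongrightarrow> of_real 1 * h x"
        by (intro tendsto_intros) auto
      then show ?case by (simp add: u_def)
    qed
  qed (use hM integrable_M_const in auto)
qed

lemma trig_approximable_sq_integrable:
  assumes h: "h \<in> sq_integrable M"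
  shows "trig_approximable h"
proof -
  \<comment> \<open>Truncation by height: the error is either 0 or h, so h itself dominates.
    \<open>Suc n\<close> keeps the level positive, as \<open>trig_approximable_bounded\<close>
    demands.\<close>
  define u where "u n x = (if cmod (h x) \<le> real (Suc n) then h x else 0)" for n x
  have hm: "h \<in> borel_measurable lebesgue"
    using sq_integrable_measurable[OF h] by simp
  have um: "u n \<in> borel_measurable lebesgue" for n
    unfolding u_def[abs_def] using hm by measurable
  show ?thesis
  proof (rule trig_approximable_limit[where u = u and w = "\<lambda>x. (cmod (h x))\<^sup>2"])
    show "trig_approximable (u n)" for n
      using um by (rule trig_approximable_bounded[where N = "real (Suc n)"]) (auto simp: u_def)
    show "u n \<in> sq_integrable M" for n
      using um by (rule sq_integrable_bounded[where C = "real (Suc n)"]) (auto simp: u_def)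
    show "AE x in M. (\<lambda>n. u n x) \<longlonglongrightarrow> h x"
    proof (intro AE_I2 tendsto_eventually)
      fix x
      obtain K where "cmod (h x) \<le> real K" using real_arch_simple by blast
      then have "u n x = h x" if "n \<ge> K" for n using that by (simp add: u_def)
      then show "\<forall>\<^sub>F n in sequentially. u n x = h x" by (auto simp: eventually_sequentially)
    qed
  qed (use h in \<open>auto simp: sq_integrable_def u_def\<close>)
qed

theorem fourier_parseval:
  assumes h: "h \<in> sq_integrable M"
  shows "((\<lambda>m. (cmod (sq_inner M (E m) h))\<^sup>2) has_sum (sq_norm2 M h)) UNIV"
proof (rule orthonormal_parseval[OF E_sq_integrable E_orthonormal h])
  fix \<delta> :: real assume "\<delta> > 0"
  then obtain p where p: "trig_poly p" "sq_norm2 M (\<lambda>x. h x - p (\<phi> x)) < \<delta>"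
    using trig_approximable_sq_integrable[OF h] unfolding trig_approximable_def by blast
  from p(1) obtain F c where "finite F" "p = (\<lambda>t. \<Sum>m\<in>F. c m * cis (2 * pi * of_int m * t))"
    by (rule trig_poly_expansion)
  then show "\<exists>F c. finite F \<and> sq_norm2 M (\<lambda>x. h x - (\<Sum>i\<in>F. c i * E i x)) < \<delta>"
    using p(2) by (intro exI[of _ F] exI[of _ c]) (simp add: E_def)
qed

end

section \<open>Tight frames of modulated translates\<close>

text \<open>Enumerating the integers by \<open>int_decode\<close> turns the sum into an ordinary
  series. Its partial sums are dominated by the integrable total s, and nonnegativity turns the
  resulting convergent series back into an unconditional sum.\<close>

lemma has_sum_integral_nonneg:
  fixes u :: "int \<Rightarrow> 'a \<Rightarrow> real"
  assumes u: "\<And>n. u n \<in> borel_measurable M" "\<And>n x. 0 \<le> u n x"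
    and s: "\<And>x. ((\<lambda>n. u n x) has_sum s x) UNIV" "integrable M s"
  shows "((\<lambda>n. integral\<^sup>L M (u n)) has_sum integral\<^sup>L M s) UNIV"
proof -
  let ?u = "\<lambda>k. u (int_decode k)"
  have reindex: "(f \<circ> int_decode has_sum t) UNIV \<longleftrightarrow> (f has_sum t) UNIV" for f :: "int \<Rightarrow> real" and t
    using has_sum_reindex_bij_betw[OF bij_int_decode, of f t] by (simp add: o_def)
  have sums: "(\<lambda>k. ?u k x) sums s x" for x
    using reindex[of "\<lambda>n. u n x" "s x"] s(1)[of x] by (intro has_sum_imp_sums) (simp add: o_def)
  have le: "(\<Sum>k<N. ?u k x) \<le> s x" for N x
    using sum_le_suminf[of "\<lambda>k. ?u k x" "{..<N}"] sums[of x] u(2) by (auto simp: sums_iff)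
  have int: "integrable M (?u k)" for k
  proof (rule Bochner_Integration.integrable_bound[OF s(2)])
    show "AE x in M. norm (?u k x) \<le> norm (s x)"
    proof (intro AE_I2)
      fix x
      have "?u k x \<le> (\<Sum>i<Suc k. ?u i x)" using u(2) by (simp add: sum_nonneg)
      then show "norm (?u k x) \<le> norm (s x)" using le[of x "Suc k"] u(2)[of "int_decode k" x] by simp
    qed
  qed (rule u(1))
  have "(\<lambda>N. LINT x|M. (\<Sum>k<N. ?u k x)) \<longlonglongrightarrow> integral\<^sup>L M s"
  proof (rule integral_dominated_convergence[OF _ _ s(2)])
    show "AE x in M. norm (\<Sum>k<N. ?u k x) \<le> s x" for N
      using le u(2) by (intro AE_I2) (simp add: sum_nonneg)
    show "AE x in M. (\<lambda>N. \<Sum>k<N. ?u k x) \<longlonglongrightarrow> s x"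
      using sums by (simp add: sums_def)
  qed (use u(1) s(2) in auto)
  then have "(\<lambda>k. integral\<^sup>L M (?u k)) sums integral\<^sup>L M s"
    unfolding sums_def by (simp add: Bochner_Integration.integral_sum int)
  then have "((\<lambda>k. integral\<^sup>L M (?u k)) has_sum integral\<^sup>L M s) UNIV"
    by (rule sums_nonneg_imp_has_sum) (simp add: u(2))
  then show ?thesis using reindex[of "\<lambda>n. integral\<^sup>L M (u n)"] by (simp add: o_def)
qed

text \<open>Nonnegativity supplies joint summability from the iterated sums, after which the total
  is the iterated one.\<close>

lemma has_sum_nonneg_Times:
  fixes f :: "'a \<times> 'b \<Rightarrow> real"
  assumes "\<And>x. ((\<lambda>y. f (x, y)) has_sum g x) UNIV" "(g has_sum s) UNIV" "\<And>z. 0 \<le> f z"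
  shows "(f has_sum s) UNIV"
proof -
  have "f summable_on UNIV \<times> UNIV"
    using assms by (intro summable_on_SigmaI[where g = g]) (auto simp: summable_on_def)
  then have "(f has_sum s) (UNIV \<times> UNIV)"
    using assms by (intro has_sum_SigmaI[where g = g]) auto
  then show ?thesis by simp
qed

lemma lebesgue_measurable_shift:
  assumes "f \<in> borel_measurable (lebesgue :: real measure)"
  shows "(\<lambda>x. f (x + c)) \<in> borel_measurable lebesgue"
proof -
  have "(\<lambda>x. c + x) \<in> lebesgue \<rightarrow>\<^sub>M (lebesgue :: real measure)"
    using lebesgue_affine_measurable[of "\<lambda>_::real. 1" c] by simp
  from measurable_compose[OF this assms] show ?thesis by (simp add: add.commute)
qed

lemma AE_lebesgue_shift:
  assumes "AE x in (lebesgue :: real measure). P x"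
  shows "AE x in lebesgue. P (x + c)"
proof -
  obtain N where N: "negligible N" "{x. \<not> P x} \<subseteq> N"
    using assms by (auto simp: eventually_ae_filter_negligible)
  have "{x. \<not> P (x + c)} \<subseteq> (+) (- c) ` N"
  proof
    fix x assume "x \<in> {x. \<not> P (x + c)}"
    then have "x + c \<in> N" using N(2) by auto
    then show "x \<in> (+) (- c) ` N" by (rule rev_image_eqI) simp
  qed
  then show ?thesis
    using negligible_translation[OF N(1), of "- c"] by (auto simp: eventually_ae_filter_negligible)
qed

lemma L2_eq: "L2 = sq_integrable lebesgue"
  by (simp add: L2_def sq_integrable_def)

lemma L2_inner_eq: "L2_inner = sq_inner lebesgue"
  by (simp add: L2_inner_def sq_inner_def fun_eq_iff)

lemma L2_norm_eq: "L2_norm f = sqrt (sq_norm2 lebesgue f)"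
  by (simp add: L2_norm_def sq_norm2_def)

section \<open>Windowed exponentials and their translates\<close>

context phase_function
begin

text \<open>For each n the translated window lives on a translated interval, where the same Fourier
  theory is needed for the translated phase.\<close>

lemma shift: "phase_function (\<lambda>x. \<phi> (x + c)) (\<lambda>x. \<phi>' (x + c)) (\<alpha> - c) (\<beta> - c)"
proof
  show "((\<lambda>x. \<phi> (x + c)) has_real_derivative \<phi>' (x + c)) (at x)" for x
    using deriv[of "x + c"] by (simp add: DERIV_shift)
  show "continuous_on UNIV (\<lambda>x. \<phi>' (x + c))"
    by (rule continuous_on_compose2[OF cont']) (auto intro!: continuous_intros)
qed (use interval pos winding in auto)

text \<open>The relation between w and \<phi>' says that, on the interval, the squared window times
  dx is C times M. This converts Lebesgue inner products with the window into inner products over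
  M.\<close>

context
  fixes w :: "real \<Rightarrow> real" and C B :: real and g :: "real \<Rightarrow> complex"
  assumes w_cont: "continuous_on UNIV w" and w: "\<And>x. (w x)\<^sup>2 = C * \<phi>' x" and C: "C > 0"
    and g: "g \<in> borel_measurable lebesgue" "\<And>x. (cmod (g x))\<^sup>2 \<le> B"
    and supp: "AE x in lebesgue. x \<notin> {\<alpha>..\<beta>} \<longrightarrow> g x = 0"
begin

lemma window_sq_integrable:
  "(\<lambda>x. c * E m x * of_real (w x) * g x) \<in> sq_integrable lebesgue"
proof (rule sq_integrable_bound)
  have "integrable lebesgue weight"
    using integrable_M_const[of 1] integrable_M[of "\<lambda>_. 1 :: real"] by simp
  then show "integrable lebesgue (\<lambda>x. ((cmod c)\<^sup>2 * C * B) * weight x)"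
    by (rule integrable_mult_right)
  show "AE x in lebesgue. (cmod (c * E m x * of_real (w x) * g x))\<^sup>2 \<le> ((cmod c)\<^sup>2 * C * B) * weight x"
    using supp
  proof eventually_elim
    case (elim x)
    have eq: "(cmod (c * E m x * of_real (w x) * g x))\<^sup>2 = (cmod c)\<^sup>2 * C * (cmod (g x))\<^sup>2 * \<phi>' x"
      by (simp add: norm_mult power_mult_distrib E_def w)
    show ?case
    proof (cases "x \<in> {\<alpha>..\<beta>}")
      case True
      then show ?thesis
        unfolding eq weight_def using g(2)[of x] C pos[of x]
        by (auto intro!: mult_right_mono mult_left_mono)
    next
      case False
      then show ?thesis using elim by (simp add: weight_def)
    qed
  qed
  show "(\<lambda>x. c * E m x * of_real (w x) * g x) \<in> borel_measurable lebesgue"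
    using g(1) continuous_measurable_lebesgue[OF w_cont] continuous_measurable_lebesgue[OF E_cont[of m]]
    by measurable
qed

lemma window_parseval:
  assumes f: "f \<in> sq_integrable lebesgue"
  shows "((\<lambda>m. (cmod (sq_inner lebesgue (\<lambda>x. cis (\<theta> m) * E m x * of_real (w x) * g x) f))\<^sup>2)
    has_sum (C * (LINT x|lebesgue. (cmod (g x))\<^sup>2 * (cmod (f x))\<^sup>2))) UNIV"
proof -
  \<comment> \<open>The coefficients of \<open>f\<close> are, up to phases, the Fourier coefficients of \<open>h\<close> in \<open>L\<^sup>2(\<phi>' dx)\<close>.\<close>
  define h where "h x = of_real (w x / \<phi>' x) * cnj (g x) * f x" for x
  have fm: "f \<in> borel_measurable lebesgue" using f by (rule sq_integrable_measurable)
  have "(\<lambda>x. w x / \<phi>' x) \<in> borel_measurable lebesgue"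
    using w_cont cont' pos
    by (intro continuous_measurable_lebesgue continuous_intros) (auto simp: less_imp_neq[symmetric])
  moreover have "(\<lambda>x. cnj (g x)) \<in> borel_measurable lebesgue"
    by (intro measurable_compose[OF g(1) borel_measurable_continuous_onI] continuous_on_cnj continuous_on_id)
  ultimately have hm: "h \<in> borel_measurable lebesgue"
    unfolding h_def[abs_def] using fm by measurable
  \<comment> \<open>On the interval the weight \<phi>' cancels against
    \<open>(w x / \<phi>' x)\<^sup>2\<close>, which equals C / \<phi>'; elsewhere both sides
    vanish.\<close>
  have sq: "weight x *\<^sub>R (cmod (h x))\<^sup>2 = C * ((cmod (g x))\<^sup>2 * (cmod (f x))\<^sup>2)"
    if "x \<notin> {\<alpha>..\<beta>} \<longrightarrow> g x = 0" for x
  proof (cases "x \<in> {\<alpha>..\<beta>}")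
    case True
    have "(cmod (h x))\<^sup>2 = C * \<phi>' x / (\<phi>' x)\<^sup>2 * (cmod (g x))\<^sup>2 * (cmod (f x))\<^sup>2"
      by (simp add: h_def norm_mult norm_divide power_mult_distrib power_divide w)
    then show ?thesis using True pos[of x] by (simp add: weight_def power2_eq_square)
  next
    case False
    then show ?thesis using that by (simp add: weight_def)
  qed
  have wm: "(\<lambda>x. weight x *\<^sub>R (cmod (h x))\<^sup>2) \<in> borel_measurable lebesgue"
    using hm by measurable
  have gfm: "(\<lambda>x. C * ((cmod (g x))\<^sup>2 * (cmod (f x))\<^sup>2)) \<in> borel_measurable lebesgue"
    using g(1) fm by measurable
  have sq_AE: "AE x in lebesgue. weight x *\<^sub>R (cmod (h x))\<^sup>2 = C * ((cmod (g x))\<^sup>2 * (cmod (f x))\<^sup>2)"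
    using supp by eventually_elim (rule sq)
  have "integrable lebesgue (\<lambda>x. weight x *\<^sub>R (cmod (h x))\<^sup>2)"
  proof (rule Bochner_Integration.integrable_bound[OF _ wm])
    show "integrable lebesgue (\<lambda>x. C * (B * (cmod (f x))\<^sup>2))"
      using f by (auto simp: sq_integrable_def)
    show "AE x in lebesgue. norm (weight x *\<^sub>R (cmod (h x))\<^sup>2) \<le> norm (C * (B * (cmod (f x))\<^sup>2))"
      using sq_AE
    proof eventually_elim
      case (elim x)
      have "0 \<le> B" using g(2)[of x] zero_le_power2 order_trans by blast
      then show ?case
        unfolding elim using g(2)[of x] C
        by (auto simp: abs_mult intro!: mult_left_mono mult_right_mono)
    qed
  qed
  then have hM: "h \<in> sq_integrable M"
    using hm integrable_M[of "\<lambda>x. (cmod (h x))\<^sup>2"] by (simp add: sq_integrable_def)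
  have norm_h: "sq_norm2 M h = C * (LINT x|lebesgue. (cmod (g x))\<^sup>2 * (cmod (f x))\<^sup>2)"
  proof -
    have "sq_norm2 M h = (LINT x|lebesgue. weight x *\<^sub>R (cmod (h x))\<^sup>2)"
      unfolding sq_norm2_def using hm by (intro integral_M) measurable
    also have "\<dots> = (LINT x|lebesgue. C * ((cmod (g x))\<^sup>2 * (cmod (f x))\<^sup>2))"
      by (rule integral_cong_AE[OF wm gfm sq_AE])
    finally show ?thesis by simp
  qed
  \<comment> \<open>On the interval weight times h is w times the conjugate of g times f, so the
    integrands agree up to the constant conjugate phase, which has modulus 1.\<close>
  have inner: "cmod (sq_inner lebesgue (\<lambda>x. cis (\<theta> m) * E m x * of_real (w x) * g x) f)
      = cmod (sq_inner M (E m) h)" for m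
  proof -
    let ?v = "\<lambda>x. cis (\<theta> m) * E m x * of_real (w x) * g x"
    have Em: "(\<lambda>x. cnj (E m x)) \<in> borel_measurable lebesgue"
      by (intro continuous_measurable_lebesgue continuous_on_cnj E_cont)
    have "sq_inner lebesgue ?v f = (LINT x|lebesgue. cnj (cis (\<theta> m)) * (weight x *\<^sub>R (cnj (E m x) * h x)))"
      unfolding sq_inner_def
    proof (rule integral_cong_AE)
      show "(\<lambda>x. cnj (?v x) * f x) \<in> borel_measurable lebesgue"
        using integrable_cnj_mult[OF f window_sq_integrable] by (rule borel_measurable_integrable)
      show "(\<lambda>x. cnj (cis (\<theta> m)) * (weight x *\<^sub>R (cnj (E m x) * h x))) \<in> borel_measurable lebesgue"
        using Em hm by measurable
      show "AE x in lebesgue. cnj (?v x) * f x = cnj (cis (\<theta> m)) * (weight x *\<^sub>R (cnj (E m x) * h x))"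
        using supp
      proof eventually_elim
        case (elim x)
        show ?case
        proof (cases "x \<in> {\<alpha>..\<beta>}")
          case True
          then have "weight x *\<^sub>R h x = of_real (w x) * cnj (g x) * f x"
            using pos[of x] by (simp add: weight_def h_def scaleR_conv_of_real)
          then have "weight x *\<^sub>R (cnj (E m x) * h x) = cnj (E m x) * (of_real (w x) * cnj (g x) * f x)"
            by (simp add: mult_scaleR_right[symmetric] del: mult_scaleR_right)
          then show ?thesis by (simp add: mult_ac)
        qed (use elim in \<open>simp add: weight_def\<close>)
      qed
    qed
    also have "\<dots> = cnj (cis (\<theta> m)) * (LINT x|lebesgue. weight x *\<^sub>R (cnj (E m x) * h x))"
      by (rule integral_mult_right_zero)
    also have "(LINT x|lebesgue. weight x *\<^sub>R (cnj (E m x) * h x)) = sq_inner M (E m) h"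
      unfolding sq_inner_def using Em hm by (intro integral_M[symmetric]) measurable
    finally show ?thesis by (simp add: norm_mult)
  qed
  show ?thesis
    unfolding inner norm_h[symmetric] by (rule fourier_parseval[OF hM])
qed

end

text \<open>The phases \<theta> may depend on n and m arbitrarily: Parseval only involves moduli of
  coefficients. The frame constant C chi then yields the normalising factor.\<close>

theorem tight_frame_of_translates:
  fixes w :: "real \<Rightarrow> real" and C q chi :: real and \<psi> f :: "real \<Rightarrow> complex"
    and \<theta> :: "int \<Rightarrow> int \<Rightarrow> real" and v :: "int \<Rightarrow> int \<Rightarrow> real \<Rightarrow> complex"
  assumes w_cont: "continuous_on UNIV w" and w: "\<And>x. (w x)\<^sup>2 = C * \<phi>' x" and C: "C > 0"
    and \<psi>: "\<psi> \<in> L2" and supp: "AE x in lebesgue. x \<notin> {\<alpha>..\<beta>} \<longrightarrow> \<psi> x = 0"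
    and chi: "chi > 0" and tight: "\<And>x. ((\<lambda>n::int. (cmod (\<psi> (x + of_int n * q)))\<^sup>2) has_sum chi) UNIV"
    and f: "f \<in> L2"
    and v: "\<And>n m x. v n m x = cis (\<theta> n m) * cis (2 * pi * of_int m * \<phi> (x + of_int n * q))
      * of_real (w (x + of_int n * q)) * \<psi> (x + of_int n * q)"
  shows "L2_has_sum (\<lambda>(n, m) x. of_real (1 / (C * chi)) * L2_inner (v n m) f * v n m x) f UNIV"
proof -
  have \<psi>_meas: "\<psi> \<in> borel_measurable lebesgue"
    using \<psi> unfolding L2_eq by (rule sq_integrable_measurable)
  \<comment> \<open>A single term of a nonnegative sum is at most its total; the term n = 0 bounds
    the window.\<close>
  have \<psi>_bound: "(cmod (\<psi> x))\<^sup>2 \<le> chi" for x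
    using finite_sum_le_has_sum[OF tight[of x], of "{0}"] by simp
  have slice: "v n m \<in> sq_integrable lebesgue"
    "h \<in> sq_integrable lebesgue \<Longrightarrow> ((\<lambda>m. (cmod (sq_inner lebesgue (v n m) h))\<^sup>2)
      has_sum (C * (LINT x|lebesgue. (cmod (\<psi> (x + of_int n * q)))\<^sup>2 * (cmod (h x))\<^sup>2))) UNIV" for n m h
  proof -
    let ?c = "of_int n * q"
    interpret S: phase_function "\<lambda>x. \<phi> (x + ?c)" "\<lambda>x. \<phi>' (x + ?c)" "\<alpha> - ?c" "\<beta> - ?c"
      by (rule shift)
    have v': "v n m = (\<lambda>x. cis (\<theta> n m) * S.E m x * of_real (w (x + ?c)) * \<psi> (x + ?c))" for m
      by (simp add: fun_eq_iff v S.E_def)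
    have 1: "continuous_on UNIV (\<lambda>x. w (x + ?c))"
      by (rule continuous_on_compose2[OF w_cont]) (auto intro!: continuous_intros)
    have 2: "(w (x + ?c))\<^sup>2 = C * \<phi>' (x + ?c)" for x
      by (rule w)
    have 3: "AE x in lebesgue. x \<notin> {\<alpha> - ?c..\<beta> - ?c} \<longrightarrow> \<psi> (x + ?c) = 0"
      using AE_lebesgue_shift[OF supp, of ?c] by (simp add: diff_le_eq le_diff_eq)
    note * = 1 2 C lebesgue_measurable_shift[OF \<psi>_meas, of ?c] \<psi>_bound 3
    show "v n m \<in> sq_integrable lebesgue"
      unfolding v' by (rule S.window_sq_integrable[OF *])
    show "((\<lambda>m. (cmod (sq_inner lebesgue (v n m) h))\<^sup>2)
      has_sum (C * (LINT x|lebesgue. (cmod (\<psi> (x + ?c)))\<^sup>2 * (cmod (h x))\<^sup>2))) UNIV"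
      if "h \<in> sq_integrable lebesgue"
      unfolding v' by (rule S.window_parseval[OF * that])
  qed
  have parseval: "((\<lambda>i. (cmod (sq_inner lebesgue (case_prod v i) h))\<^sup>2)
      has_sum (C * chi * sq_norm2 lebesgue h)) UNIV" if h: "h \<in> sq_integrable lebesgue" for h
  proof (rule has_sum_nonneg_Times)
    show "((\<lambda>m. (cmod (sq_inner lebesgue (case_prod v (n, m)) h))\<^sup>2)
      has_sum (C * (LINT x|lebesgue. (cmod (\<psi> (x + of_int n * q)))\<^sup>2 * (cmod (h x))\<^sup>2))) UNIV" for n
      using slice(2)[OF h] by simp
    have "((\<lambda>n. LINT x|lebesgue. (cmod (\<psi> (x + of_int n * q)))\<^sup>2 * (cmod (h x))\<^sup>2)
      has_sum (LINT x|lebesgue. chi * (cmod (h x))\<^sup>2)) UNIV"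
    proof (rule has_sum_integral_nonneg)
      show "(\<lambda>x. (cmod (\<psi> (x + of_int n * q)))\<^sup>2 * (cmod (h x))\<^sup>2) \<in> borel_measurable lebesgue" for n
        using lebesgue_measurable_shift[OF \<psi>_meas] sq_integrable_measurable[OF h] by measurable
      show "((\<lambda>n. (cmod (\<psi> (x + of_int n * q)))\<^sup>2 * (cmod (h x))\<^sup>2) has_sum chi * (cmod (h x))\<^sup>2) UNIV" for x
        using tight by (rule has_sum_cmult_left)
    qed (use h in \<open>auto simp: sq_integrable_def\<close>)
    then have "((\<lambda>n. LINT x|lebesgue. (cmod (\<psi> (x + of_int n * q)))\<^sup>2 * (cmod (h x))\<^sup>2)
      has_sum (chi * sq_norm2 lebesgue h)) UNIV"
      by (simp add: sq_norm2_def)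
    from has_sum_cmult_right[OF this, of C]
    show "((\<lambda>n. C * (LINT x|lebesgue. (cmod (\<psi> (x + of_int n * q)))\<^sup>2 * (cmod (h x))\<^sup>2))
      has_sum (C * chi * sq_norm2 lebesgue h)) UNIV"
      by (simp add: mult.assoc)
  qed auto
  have "((\<lambda>F. sq_norm2 lebesgue (\<lambda>x. f x - (\<Sum>i\<in>F. (sq_inner lebesgue (case_prod v i) f / of_real (C * chi)) * case_prod v i x)))
      \<longlongrightarrow> 0) (finite_subsets_at_top UNIV)"
    using slice(1) C chi f
    by (intro tight_frame_expansion) (auto simp: L2_eq intro: parseval simp del: split_paired_All)
  from tendsto_real_sqrt[OF this]
  have "((\<lambda>F. L2_norm (\<lambda>x. f x - (\<Sum>i\<in>F. (case i of (n, m) \<Rightarrow> \<lambda>x. of_real (1 / (C * chi)) * L2_inner (v n m) f * v n m x) x)))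
      \<longlongrightarrow> 0) (finite_subsets_at_top UNIV)"
    by (simp add: L2_norm_eq L2_inner_eq case_prod_beta field_simps)
  moreover have "(\<lambda>x. of_real (1 / (C * chi)) * L2_inner (v n m) f * v n m x) \<in> L2" for n m
    unfolding L2_eq by (intro sq_integrable_scale slice(1))
  ultimately show ?thesis
    unfolding L2_has_sum_def using f by auto
qed

end

section \<open>The affine and Heisenberg instances\<close>

theorem mainTheorem10:
  fixes A B a0 b0 L p0 q0 chi \<epsilon> :: real
    and a b :: "real \<Rightarrow> real"
    and \<psi> f :: "real \<Rightarrow> complex"
  assumes "A \<noteq> 0"
    and "a0 + b0 = B"
    and "\<And>e. e \<in> {0<..1} \<Longrightarrow> a e = a0 + A / e"
    and "\<And>e. e \<in> {0<..1} \<Longrightarrow> b e = b0 - A / e"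
    and "\<And>e. e \<in> {0<..1} \<Longrightarrow> b e \<noteq> 0"
    and "L > 0"
    and "\<psi> \<in> L2"
    and "\<not> (AE x in lebesgue. \<psi> x = 0)"
    and "AE x in lebesgue. x \<notin> {-L..L} \<longrightarrow> \<psi> x = 0"
    and "p0 = pi / (A * L)"
    and "\<bar>q0 * p0\<bar> < 2 * pi"
    and "chi > 0"
    and "\<And>x. ((\<lambda>n::int. (cmod (\<psi> (x + of_int n * q0)))\<^sup>2) has_sum chi) UNIV"
    and "f \<in> L2"
    and "\<epsilon> \<in> {0<..1}"
  shows "L2_has_sum
           (\<lambda>(n, m) x. of_real (\<epsilon> / (2 * chi * sinh (\<epsilon> * L)))
              * L2_inner (ea_vec q0 L \<epsilon> (a \<epsilon>) (b \<epsilon>) \<psi> n m) f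
              * ea_vec q0 L \<epsilon> (a \<epsilon>) (b \<epsilon>) \<psi> n m x)
           f (UNIV :: (int \<times> int) set)
       \<and> L2_has_sum
           (\<lambda>(n, m) x. of_real (1 / (2 * chi * L))
              * L2_inner (heis_vec A B q0 p0 \<psi> n m) f
              * heis_vec A B q0 p0 \<psi> n m x)
           f (UNIV :: (int \<times> int) set)"
proof
  have eps: "\<epsilon> > 0" and b: "b \<epsilon> \<noteq> 0"
    using assms(5,15) by auto
  \<comment> \<open>T is the difference of exponentials in the denominator of
    \<open>ea_beta\<close>, that is 2 sinh(\<epsilon> L). Dividing by it makes the affine phase grow
    by exactly 1 over the interval.\<close>
  define T where "T = exp (\<epsilon> * L) - exp (- (\<epsilon> * L))"
  have T: "T > 0"
    using eps \<open>L > 0\<close> by (simp add: T_def)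
  interpret ea: phase_function "\<lambda>y. - exp (- (\<epsilon> * y)) / T" "\<lambda>y. \<epsilon> * exp (- (\<epsilon> * y)) / T" "- L" L
  proof
    show "((\<lambda>y. - exp (- (\<epsilon> * y)) / T) has_real_derivative \<epsilon> * exp (- (\<epsilon> * y)) / T) (at y)" for y
      using T by (auto intro!: derivative_eq_intros)
    show "continuous_on UNIV (\<lambda>y. \<epsilon> * exp (- (\<epsilon> * y)) / T)"
      using T by (intro continuous_intros) auto
    show "- exp (- (\<epsilon> * L)) / T - - exp (- (\<epsilon> * - L)) / T = 1"
      using T eps \<open>L > 0\<close> by (simp add: T_def flip: diff_divide_distrib)
  qed (use eps T \<open>L > 0\<close> in auto)
  have "L2_has_sum (\<lambda>(n, m) x. of_real (1 / (T / \<epsilon> * chi))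
      * L2_inner (ea_vec q0 L \<epsilon> (a \<epsilon>) (b \<epsilon>) \<psi> n m) f * ea_vec q0 L \<epsilon> (a \<epsilon>) (b \<epsilon>) \<psi> n m x) f UNIV"
  \<comment> \<open>The central coordinate contributes a phase constant in x, which is taken as
    \<theta>.\<close>
  proof (rule ea.tight_frame_of_translates[where w = "Q_fun \<epsilon>"
        and \<theta> = "\<lambda>n m. a \<epsilon> * ea_gamma q0 L \<epsilon> (b \<epsilon>) m n"])
    show "continuous_on UNIV (Q_fun \<epsilon>)"
      unfolding Q_fun_def[abs_def] by (intro continuous_intros)
    \<comment> \<open>The square of \<open>Q_fun\<close> is \<open>exp (- (\<epsilon> * x))\<close>,
      proportional to the derivative of the phase; this fixes C = T / \<epsilon>.\<close>
    show "(Q_fun \<epsilon> x)\<^sup>2 = T / \<epsilon> * (\<epsilon> * exp (- (\<epsilon> * x)) / T)" for x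
      using eps T by (simp add: Q_fun_def power2_eq_square flip: exp_add)
    show "ea_vec q0 L \<epsilon> (a \<epsilon>) (b \<epsilon>) \<psi> n m x = cis (a \<epsilon> * ea_gamma q0 L \<epsilon> (b \<epsilon>) m n)
        * cis (2 * pi * of_int m * (- exp (- (\<epsilon> * (x + of_int n * q0))) / T))
        * of_real (Q_fun \<epsilon> (x + of_int n * q0)) * \<psi> (x + of_int n * q0)" for n m x
    proof -
      have "exp (- (\<epsilon> * (x + of_int n * q0))) = exp (- (\<epsilon> * of_int n * q0)) * exp (- (\<epsilon> * x))"
        by (simp add: algebra_simps flip: exp_add)
      \<comment> \<open>The parameter b cancels against the one in \<open>ea_beta\<close>, and the
        exponential in n there moves the evaluation point to the translate.\<close>
      then have phase: "b \<epsilon> * ea_beta q0 L \<epsilon> (b \<epsilon>) m n * exp (- (\<epsilon> * x))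
          = 2 * pi * of_int m * (- exp (- (\<epsilon> * (x + of_int n * q0))) / T)"
        using b T by (simp add: ea_beta_def flip: T_def)
      \<comment> \<open>The logarithm of \<open>ea_alpha\<close> is linear in n, so the dilation
        acts as a translation by n q0.\<close>
      have translate: "x - ln (ea_alpha q0 \<epsilon> n) / \<epsilon> = x + of_int n * q0"
        using eps by (simp add: ea_alpha_def)
      show ?thesis
        unfolding ea_vec_def ea_rep_def prod.case phase translate by (simp only: mult.assoc)
    qed
  qed (use assms eps T in auto)
  then show "L2_has_sum (\<lambda>(n, m) x. of_real (\<epsilon> / (2 * chi * sinh (\<epsilon> * L)))
      * L2_inner (ea_vec q0 L \<epsilon> (a \<epsilon>) (b \<epsilon>) \<psi> n m) f * ea_vec q0 L \<epsilon> (a \<epsilon>) (b \<epsilon>) \<psi> n m x) f UNIV"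
    by (simp add: T_def sinh_def mult.commute)
next
  interpret heis: phase_function "\<lambda>y. y / (2 * L)" "\<lambda>_. 1 / (2 * L)" "- L" L
    using \<open>L > 0\<close> by unfold_locales (auto intro!: derivative_eq_intros simp: field_simps)
  have "L2_has_sum (\<lambda>(n, m) x. of_real (1 / (2 * L * chi))
      * L2_inner (heis_vec A B q0 p0 \<psi> n m) f * heis_vec A B q0 p0 \<psi> n m x) f UNIV"
  proof (rule heis.tight_frame_of_translates[where w = "\<lambda>_. 1"
        \<comment> \<open>Writing x as (x + n q0) - n q0 in the Heisenberg phase leaves -1 + 1/2 of
          the term A n q0 m p0, hence the minus sign and the half.\<close>
        and \<theta> = "\<lambda>n m. B * (of_int m * p0) - A * (of_int n * q0 * (of_int m * p0)) / 2"])
    show "heis_vec A B q0 p0 \<psi> n m x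
        = cis (B * (of_int m * p0) - A * (of_int n * q0 * (of_int m * p0)) / 2)
        * cis (2 * pi * of_int m * ((x + of_int n * q0) / (2 * L))) * of_real 1 * \<psi> (x + of_int n * q0)" for n m x
    proof -
      \<comment> \<open>The value of p0 is exactly the one for which frequency m means m full turns
        over an interval of length 2 L.\<close>
      have "2 * pi * of_int m * ((x + of_int n * q0) / (2 * L)) = A * p0 * of_int m * (x + of_int n * q0)"
        using \<open>A \<noteq> 0\<close> \<open>L > 0\<close> by (simp add: \<open>p0 = _\<close>)
      then show ?thesis
        by (simp add: heis_vec_def heis_rep_def cis_mult algebra_simps)
    qed
  qed (use assms in auto)
  then show "L2_has_sum (\<lambda>(n, m) x. of_real (1 / (2 * chi * L))
      * L2_inner (heis_vec A B q0 p0 \<psi> n m) f * heis_vec A B q0 p0 \<psi> n m x) f UNIV"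
    by (simp add: mult_ac)
qed

end
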